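(* For every graph $F$ of diameter $2$, there exist infinitely many pairwise non-isomorphic graphs $G$ of diameter $3$ that are $F$-irregular.
   Context: All graphs are simple, finite, undirected and non-trivial. For graphs $F$ and $G$ and a vertex $v$ of $G$, the $F$-degree of $v$ in $G$ is the number of subgraphs of $G$ (not necessarily induced) that are isomorphic to $F$ and contain $v$. A graph $G$ is $F$-irregular if any two distinct vertices of $G$ have different $F$-degrees. *)

theory Defs
  imports Main
begin

type_synonym 'a ugraph = "'a set \<times> 'a set set"

definition verts :: "'a ugraph \<Rightarrow> 'a set" where "verts G = fst G"
definition edges :: "'a ugraph \<Rightarrow> 'a set set" where "edges G = snd G"

definition is_graph :: "'a ugraph \<Rightarrow> bool" where
  "is_graph G \<longleftrightarrow> finite (verts G) \<and> card (verts G) \<ge> 2 \<and>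
     (\<forall>e\<in>edges G. \<exists>x y. x \<noteq> y \<and> e = {x, y} \<and> x \<in> verts G \<and> y \<in> verts G)"

definition subgraph :: "'a ugraph \<Rightarrow> 'a ugraph \<Rightarrow> bool" where
  "subgraph H G \<longleftrightarrow> is_graph H \<and> verts H \<subseteq> verts G \<and> edges H \<subseteq> edges G"

definition graph_iso :: "'a ugraph \<Rightarrow> 'b ugraph \<Rightarrow> bool" where
  "graph_iso G H \<longleftrightarrow> (\<exists>f. bij_betw f (verts G) (verts H) \<and>
     (\<forall>x\<in>verts G. \<forall>y\<in>verts G. {x, y} \<in> edges G \<longleftrightarrow> {f x, f y} \<in> edges H))"

definition F_degree :: "'b ugraph \<Rightarrow> 'a ugraph \<Rightarrow> 'a \<Rightarrow> nat" where
  "F_degree F G v = card {H. subgraph H G \<and> graph_iso H F \<and> v \<in> verts H}"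

definition F_irregular :: "'b ugraph \<Rightarrow> 'a ugraph \<Rightarrow> bool" where
  "F_irregular F G \<longleftrightarrow> (\<forall>u\<in>verts G. \<forall>v\<in>verts G. u \<noteq> v \<longrightarrow> F_degree F G u \<noteq> F_degree F G v)"

definition walk_len :: "'a ugraph \<Rightarrow> nat \<Rightarrow> 'a \<Rightarrow> 'a \<Rightarrow> bool" where
  "walk_len G n u v \<longleftrightarrow> (\<exists>p. length p = Suc n \<and> hd p = u \<and> last p = v \<and>
     set p \<subseteq> verts G \<and> (\<forall>i<n. {p ! i, p ! Suc i} \<in> edges G))"

definition connected_graph :: "'a ugraph \<Rightarrow> bool" where
  "connected_graph G \<longleftrightarrow> (\<forall>u\<in>verts G. \<forall>v\<in>verts G. \<exists>n. walk_len G n u v)"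

definition gdist :: "'a ugraph \<Rightarrow> 'a \<Rightarrow> 'a \<Rightarrow> nat" where
  "gdist G u v = (LEAST n. walk_len G n u v)"

definition has_diameter :: "'a ugraph \<Rightarrow> nat \<Rightarrow> bool" where
  "has_diameter G d \<longleftrightarrow> connected_graph G \<and>
     Max {gdist G u v | u v. u \<in> verts G \<and> v \<in> verts G} = d"

end

theory Submission
  imports Complex_Main Defs "HOL-Combinatorics.Transposition"
begin

text \<open>
  Let $k$ be the order of $F$ and $n$ large. The host graph has two cliques $a_0, \dots, a_{n-1}$ and
  $b_0, \dots, b_{n-1}$, with $a_i$ adjacent to $b_j$ iff $i + j \ge n$, and one further vertex $z$
  adjacent to $a_0, \dots, a_{k-1}$; the vertices $z$ and $b_0$ are at distance 3. Without $z$, the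
  exchange of $a_i$ and $b_i$ is an automorphism and $b_{i+1}$ dominates $b_i$, having the additional
  neighbour $a_{n-1-i}$; this gives $b_{i+1}$ at least $c n^{k-2}$ more copies than $b_i$.
  A copy of $F$ through $z$ has diameter 2, so it contains $b_l$ only for $l > n - k$; for such copies
  $a_i$ dominates $b_i$. Hence $z$ breaks the tie between $a_i$ and $b_i$ in favour of $a_i$, but only
  by an amount smaller than the gap to $b_{i+1}$, and the degrees increase along
  $z, b_0, a_0, b_1, a_1, \dots$
\<close>

subsection \<open>Copies of a graph\<close>

text \<open>The condition i + j \<ge> n makes the neighbourhoods within each clique nested, which
  separates different indices; being symmetric in i and j, it leaves \<open>av i\<close> and
  \<open>bv i\<close> tied. The vertex \<open>0\<close> (z) has k neighbours: enough that any vertex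
  of F can be placed on it, as degrees in F are below k, yet a number independent of n, so that
  copies through \<open>0\<close> are comparatively rare. Rarity alone does not settle the
  comparison of \<open>av i\<close> with \<open>bv (Suc i)\<close>. For i < k there can be on the
  order of n^(k-2) copies through \<open>0\<close> and \<open>av i\<close> (let F be a star with its
  centre on \<open>av i\<close>), the same order as the guaranteed gap. But these copies are rigid:
  apart from O(n^(k-3)) exceptions, \<open>0\<close> is a leaf at \<open>av i\<close> and the rest
  lies among the \<open>av j\<close>. They are mapped injectively into the gap, and a family of
  order n^(k-2), with all but one vertex in the other clique, is left over and absorbs the
  exceptions. For i \<ge> k every copy through \<open>0\<close> and \<open>av i\<close> is an
  exception, since it contains a third vertex among the neighbours of \<open>0\<close>.\<close>

definition copies :: "'b ugraph \<Rightarrow> 'a ugraph \<Rightarrow> 'a ugraph set" where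
  "copies F G = {H. subgraph H G \<and> graph_iso H F}"

definition graph_image :: "('a \<Rightarrow> 'b) \<Rightarrow> 'a ugraph \<Rightarrow> 'b ugraph" where
  "graph_image f G = (f ` verts G, (`) f ` edges G)"

lemma verts_graph_image [simp]: "verts (graph_image f G) = f ` verts G"
  and edges_graph_image [simp]: "edges (graph_image f G) = (`) f ` edges G"
  by (simp_all add: graph_image_def verts_def edges_def)

lemma ugraph_eqI: "verts G = verts H \<Longrightarrow> edges G = edges H \<Longrightarrow> G = H"
  by (simp add: verts_def edges_def prod_eq_iff)

lemma inj_graph_image: "inj f \<Longrightarrow> inj (graph_image f)"
proof (rule injI)
  fix G H assume f: "inj f" and eq: "graph_image f G = graph_image f H"
  have "f ` verts G = f ` verts H" using arg_cong[OF eq, of verts] by simp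
  moreover have "(`) f ` edges G = (`) f ` edges H" using arg_cong[OF eq, of edges] by simp
  moreover have "inj ((`) f)" using f by (simp add: inj_def inj_image_eq_iff)
  ultimately show "G = H" using f by (intro ugraph_eqI) (simp_all add: inj_image_eq_iff)
qed

lemma graph_image_comp: "graph_image f (graph_image g G) = graph_image (f \<circ> g) G"
  by (simp add: graph_image_def verts_def edges_def image_comp comp_def image_image)

lemma edge_doubletonE:
  assumes "is_graph G" "e \<in> edges G"
  obtains x y where "x \<noteq> y" "e = {x, y}" "x \<in> verts G" "y \<in> verts G"
  using assms unfolding is_graph_def by blast

lemma edge_subset_verts: "is_graph G \<Longrightarrow> e \<in> edges G \<Longrightarrow> e \<subseteq> verts G"
  by (auto elim: edge_doubletonE)

lemma edge_endpoints_distinct: "is_graph G \<Longrightarrow> {x, y} \<in> edges G \<Longrightarrow> x \<noteq> y"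
  by (metis doubleton_eq_iff edge_doubletonE)

lemma is_graph_image:
  assumes G: "is_graph G" and inj: "inj_on f (verts G)"
  shows "is_graph (graph_image f G)"
proof -
  have "\<exists>x y. x \<noteq> y \<and> f ` e = {x, y} \<and> x \<in> f ` verts G \<and> y \<in> f ` verts G"
    if e: "e \<in> edges G" for e
  proof -
    obtain x y where "x \<noteq> y" "e = {x, y}" "x \<in> verts G" "y \<in> verts G"
      using edge_doubletonE[OF G e] by blast
    then show ?thesis
      using inj_onD[OF inj, of x y] by (intro exI[of _ "f x"] exI[of _ "f y"]) auto
  qed
  then show ?thesis
    using G inj by (auto simp: is_graph_def card_image)
qed

lemma graph_iso_image:
  assumes G: "is_graph G" and inj: "inj_on f (verts G)"
  shows "graph_iso (graph_image f G) G"
  unfolding graph_iso_def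
proof (intro exI conjI ballI)
  let ?g = "the_inv_into (verts G) f"
  show "bij_betw ?g (verts (graph_image f G)) (verts G)"
    using inj by (simp add: bij_betw_the_inv_into inj_on_imp_bij_betw)
  fix x y assume "x \<in> verts (graph_image f G)" "y \<in> verts (graph_image f G)"
  then obtain u v where uv: "x = f u" "y = f v" "u \<in> verts G" "v \<in> verts G" by auto
  have "{u, v} \<in> edges G" if "{f u, f v} = f ` e" "e \<in> edges G" for e
  proof -
    have "f ` {u, v} = f ` e" using that by simp
    then have "{u, v} = e"
      using inj_on_image_eq_iff[OF inj, of "{u,v}" e] uv edge_subset_verts[OF G that(2)] by auto
    then show ?thesis using that by simp
  qed
  moreover have "{f u, f v} = f ` {u, v}" by simp
  ultimately have "{f u, f v} \<in> (`) f ` edges G \<longleftrightarrow> {u, v} \<in> edges G" by blast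
  then show "{x, y} \<in> edges (graph_image f G) \<longleftrightarrow> {?g x, ?g y} \<in> edges G"
    using uv inj by (simp add: the_inv_into_f_f)
qed

text \<open>The definition leaves the isomorphism implicit. This form supplies an explicit injective
  placement \<open>f\<close> of \<open>F\<close>, which is what later constructions build and
  compose. Different \<open>f\<close> may yield the same \<open>H\<close>.\<close>

lemma copies_iff:
  assumes F: "is_graph F"
  shows "H \<in> copies F G \<longleftrightarrow>
    (\<exists>f. inj_on f (verts F) \<and> H = graph_image f F \<and> verts H \<subseteq> verts G \<and> edges H \<subseteq> edges G)"
    (is "?L \<longleftrightarrow> ?R")
proof
  assume ?L
  then have H: "is_graph H" "verts H \<subseteq> verts G" "edges H \<subseteq> edges G" and "graph_iso H F"
    by (auto simp: copies_def subgraph_def)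
  then obtain g where g: "bij_betw g (verts H) (verts F)"
    and e: "\<And>x y. x \<in> verts H \<Longrightarrow> y \<in> verts H \<Longrightarrow> {x, y} \<in> edges H \<longleftrightarrow> {g x, g y} \<in> edges F"
    unfolding graph_iso_def by blast
  define f where "f = the_inv_into (verts H) g"
  have f: "bij_betw f (verts F) (verts H)"
    using g by (simp add: f_def bij_betw_the_inv_into)
  have gf: "g (f x) = x" if "x \<in> verts F" for x
    using that g by (simp add: f_def bij_betw_def f_the_inv_into_f)
  have fg: "f (g x) = x" if "x \<in> verts H" for x
    using that g by (simp add: f_def bij_betw_def the_inv_into_f_f)
  have "edges H = (`) f ` edges F"
  proof (intro equalityI subsetI)
    fix d assume d: "d \<in> edges H"
    then obtain x y where xy: "d = {x, y}" "x \<in> verts H" "y \<in> verts H"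
      using edge_doubletonE[OF H(1)] by blast
    then have "{g x, g y} \<in> edges F" "d = f ` {g x, g y}" using e d fg by auto
    then show "d \<in> (`) f ` edges F" by blast
  next
    fix d assume "d \<in> (`) f ` edges F"
    then obtain c where c: "c \<in> edges F" "d = f ` c" by blast
    then obtain x y where xy: "c = {x, y}" "x \<in> verts F" "y \<in> verts F"
      using edge_doubletonE[OF F] by blast
    then show "d \<in> edges H"
      using c e[of "f x" "f y"] gf bij_betwE[OF f] by auto
  qed
  moreover have "verts H = f ` verts F" using f by (simp add: bij_betw_def)
  ultimately have "H = graph_image f F" by (intro ugraph_eqI) auto
  then show ?R using f H by (auto simp: bij_betw_def)
next
  assume ?R
  then show ?L
    using is_graph_image[OF F] graph_iso_image[OF F] by (auto simp: copies_def subgraph_def)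
qed

text \<open>Only the edges of \<open>H\<close> have to be respected. This matters because the vertex
  maps used later are not automorphisms of the host.\<close>

lemma graph_image_copy:
  assumes F: "is_graph F" and H: "H \<in> copies F G" and inj: "inj_on \<phi> (verts H)"
    and V: "\<And>x. x \<in> verts H \<Longrightarrow> \<phi> x \<in> verts G'"
    and E: "\<And>x y. {x, y} \<in> edges H \<Longrightarrow> {\<phi> x, \<phi> y} \<in> edges G'"
  shows "graph_image \<phi> H \<in> copies F G'"
proof -
  obtain f where f: "inj_on f (verts F)" "H = graph_image f F"
    using H copies_iff[OF F] by blast
  have gH: "is_graph H" using H by (simp add: copies_def subgraph_def)
  have "edges (graph_image \<phi> H) \<subseteq> edges G'"
  proof
    fix e assume "e \<in> edges (graph_image \<phi> H)"
    then obtain c where "c \<in> edges H" "e = \<phi> ` c" by auto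
    then show "e \<in> edges G'" using edge_doubletonE[OF gH] E by (metis image_empty image_insert)
  qed
  moreover have "graph_image \<phi> H = graph_image (\<phi> \<circ> f) F" using f graph_image_comp by simp
  moreover have "inj_on (\<phi> \<circ> f) (verts F)" using f inj by (simp add: comp_inj_on)
  moreover have "verts (graph_image \<phi> H) \<subseteq> verts G'" using V by auto
  ultimately show ?thesis using copies_iff[OF F] by blast
qed

lemma copiesD:
  assumes "H \<in> copies F G"
  shows "is_graph H" "verts H \<subseteq> verts G" "edges H \<subseteq> edges G"
  using assms by (auto simp: copies_def subgraph_def)

lemma card_verts_copy: "H \<in> copies F G \<Longrightarrow> card (verts H) = card (verts F)"
  by (auto simp: copies_def graph_iso_def bij_betw_same_card)

section \<open>Upper and lower bounds for numbers of copies\<close>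

lemma edges_subset_Pow: "is_graph G \<Longrightarrow> edges G \<subseteq> Pow (verts G)"
  using edge_subset_verts by blast

lemma finite_copies:
  assumes "is_graph G"
  shows "finite (copies F G)"
proof (rule finite_subset)
  show "copies F G \<subseteq> Pow (verts G) \<times> Pow (Pow (verts G))"
  proof
    fix H assume H: "H \<in> copies F G"
    show "H \<in> Pow (verts G) \<times> Pow (Pow (verts G))"
      using copiesD[OF H] edges_subset_Pow[OF assms] by (cases H) (auto simp: verts_def edges_def)
  qed
  show "finite (Pow (verts G) \<times> Pow (Pow (verts G)))"
    using assms by (simp add: is_graph_def)
qed

lemma F_degree_eq: "F_degree F G v = card {H \<in> copies F G. v \<in> verts H}"
  unfolding F_degree_def copies_def by (rule arg_cong[of _ _ card]) auto

text \<open>The factor bounds the number of edge sets on a fixed set of vertices.\<close>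

lemma card_copies_containing_le:
  assumes G: "is_graph G" and T: "finite T"
  shows "card {H \<in> copies F G. T \<subseteq> verts H}
    \<le> 2 ^ 2 ^ card (verts F) * card (verts G) ^ (card (verts F) - card T)"
proof -
  let ?k = "card (verts F)" and ?N = "card (verts G)"
  let ?P = "{W. W \<subseteq> verts G \<and> card W = ?k - card T}"
  let ?C = "\<lambda>W. {H \<in> copies F G. verts H = W \<union> T}"
  have finV: "finite (verts G)" using G by (simp add: is_graph_def)
  have fin: "finite {H \<in> copies F G. P H}" for P using finite_copies[OF G, of F] by simp
  have "{H \<in> copies F G. T \<subseteq> verts H} \<subseteq> (\<Union>W\<in>?P. ?C W)"
  proof
    fix H assume H: "H \<in> {H \<in> copies F G. T \<subseteq> verts H}"
    have "card (verts H - T) = ?k - card T"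
      using H card_verts_copy[of H F G] T by (simp add: card_Diff_subset)
    moreover have "verts H - T \<subseteq> verts G" using H copiesD(2)[of H F G] by blast
    moreover have "H \<in> ?C (verts H - T)" using H by auto
    ultimately show "H \<in> (\<Union>W\<in>?P. ?C W)" by blast
  qed
  then have "card {H \<in> copies F G. T \<subseteq> verts H} \<le> card (\<Union>W\<in>?P. ?C W)"
    by (rule card_mono[rotated]) (use finV fin in auto)
  also have "\<dots> \<le> (\<Sum>W\<in>?P. card (?C W))"
    using finV by (intro card_UN_le) auto
  also have "\<dots> \<le> (\<Sum>W\<in>?P. 2 ^ 2 ^ ?k)"
  proof (rule sum_mono)
    fix W assume "W \<in> ?P"
    then have finW: "finite (W \<union> T)" using finV T finite_subset by auto
    show "card (?C W) \<le> 2 ^ 2 ^ ?k"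
    proof (cases "?C W = {}")
      case True
      then show ?thesis by (simp only: card.empty)
    next
      case False
      then obtain H where "H \<in> copies F G" "verts H = W \<union> T" by blast
      then have c: "card (W \<union> T) = ?k" using card_verts_copy by metis
      have "inj_on edges (?C W)" by (rule inj_onI) (simp add: ugraph_eqI)
      moreover have "edges ` ?C W \<subseteq> Pow (Pow (W \<union> T))"
      proof (intro image_subsetI)
        fix H assume "H \<in> ?C W"
        then show "edges H \<in> Pow (Pow (W \<union> T))"
          using edges_subset_Pow[of H] copiesD(1)[of H F G] by simp
      qed
      ultimately have "card (?C W) \<le> card (Pow (Pow (W \<union> T)))"
        using finW by (intro card_inj_on_le) auto
      then show ?thesis using c finW by (simp add: card_Pow)
    qed
  qed
  also have "\<dots> = (?N choose (?k - card T)) * 2 ^ 2 ^ ?k"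
    using finV by (simp add: n_subsets)
  also have "\<dots> \<le> ?N ^ (?k - card T) * 2 ^ 2 ^ ?k"
    by (cases "?k - card T \<le> ?N") (simp_all add: binomial_le_pow binomial_eq_0)
  finally show ?thesis by (simp add: mult.commute)
qed

text \<open>\<open>T\<close> goes where \<open>h\<close> sends it, and the rest of \<open>F\<close>
  goes bijectively onto an arbitrary subset \<open>W\<close> of \<open>Q\<close> of the right size;
  a clique provides every edge. As \<open>Q\<close> misses the image of \<open>T\<close>, the vertex
  set of the copy recovers \<open>W\<close>, so distinct subsets give distinct copies. The last
  clause records the prescribed edges that the copy uses.\<close>

lemma choose_le_card_copies_in_clique:
  assumes F: "is_graph F" and G: "is_graph G"
    and T: "T \<subseteq> verts F" and h: "inj_on h T" and Q: "finite Q" "Q \<inter> h ` T = {}"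
    and V: "h ` T \<union> Q \<subseteq> verts G"
    and clique: "\<And>x y. x \<in> h ` T \<union> Q \<Longrightarrow> y \<in> h ` T \<union> Q \<Longrightarrow> x \<noteq> y \<Longrightarrow> {x, y} \<in> edges G"
  shows "card Q choose (card (verts F) - card T) \<le>
    card {H \<in> copies F G. h ` T \<subseteq> verts H \<and> verts H \<subseteq> h ` T \<union> Q \<and>
      (\<forall>e\<in>edges F. e \<subseteq> T \<longrightarrow> h ` e \<in> edges H)}" (is "_ \<le> card ?S")
proof -
  let ?r = "card (verts F) - card T"
  let ?P = "{W. W \<subseteq> Q \<and> card W = ?r}"
  have finF: "finite (verts F)" using F by (simp add: is_graph_def)
  have ex: "\<exists>H. H \<in> ?S \<and> verts H = h ` T \<union> W" if W: "W \<in> ?P" for W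
  proof -
    have "card (verts F - T) = card W" using T W finF by (simp add: card_Diff_subset finite_subset)
    moreover have "finite W" using W Q finite_subset by blast
    ultimately obtain g where g: "bij_betw g (verts F - T) W"
      using finF finite_same_card_bij by blast
    define f where "f x = (if x \<in> T then h x else g x)" for x
    have fim: "f ` verts F = h ` T \<union> W"
    proof -
      have "verts F = T \<union> (verts F - T)" using T by blast
      then have "f ` verts F = f ` T \<union> f ` (verts F - T)" by (metis image_Un)
      also have "f ` T = h ` T" by (simp add: f_def)
      also have "f ` (verts F - T) = W" using g by (auto simp: f_def bij_betw_def)
      finally show ?thesis .
    qed
    have finj: "inj_on f (verts F)"
    proof (rule inj_onI)
      fix x y assume xy: "x \<in> verts F" "y \<in> verts F" "f x = f y"
      have gW: "u \<in> verts F - T \<Longrightarrow> g u \<in> Q" for u using bij_betwE[OF g] W by blast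
      show "x = y"
      proof (cases "x \<in> T \<longleftrightarrow> y \<in> T")
        case True
        then show ?thesis
          using xy inj_onD[OF h, of x y] inj_onD[OF bij_betw_imp_inj_on[OF g], of x y]
          by (auto simp: f_def split: if_splits)
      next
        case False
        then have "h x \<in> Q \<and> x \<in> T \<or> h y \<in> Q \<and> y \<in> T"
          using xy gW[of x] gW[of y] by (auto simp: f_def split: if_splits)
        then show ?thesis using Q(2) by blast
      qed
    qed
    have "edges (graph_image f F) \<subseteq> edges G"
    proof
      fix e assume "e \<in> edges (graph_image f F)"
      then obtain c where c: "c \<in> edges F" "e = f ` c" by auto
      then obtain x y where xy: "x \<noteq> y" "c = {x, y}" "x \<in> verts F" "y \<in> verts F"
        using edge_doubletonE[OF F] by blast
      then have "f x \<noteq> f y" using finj by (auto dest: inj_onD)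
      moreover have "f x \<in> h ` T \<union> Q" "f y \<in> h ` T \<union> Q" using fim xy W by blast+
      ultimately show "e \<in> edges G" using clique c xy by simp
    qed
    then have "graph_image f F \<in> copies F G"
      unfolding copies_iff[OF F] using finj fim V W by (intro exI[of _ f]) auto
    moreover have "h ` e \<in> edges (graph_image f F)" if "e \<in> edges F" "e \<subseteq> T" for e
    proof -
      have "h ` e = f ` e" using that by (intro image_cong) (auto simp: f_def)
      then show ?thesis using that by auto
    qed
    ultimately show ?thesis using fim W by (intro exI[of _ "graph_image f F"]) auto
  qed
  define H where "H W = (SOME H. H \<in> ?S \<and> verts H = h ` T \<union> W)" for W
  have H: "H W \<in> ?S \<and> verts (H W) = h ` T \<union> W" if "W \<in> ?P" for W
    unfolding H_def by (rule someI_ex) (rule ex[OF that])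
  have "inj_on H ?P"
  proof (rule inj_onI)
    fix W W' assume W: "W \<in> ?P" "W' \<in> ?P" "H W = H W'"
    then have "h ` T \<union> W = h ` T \<union> W'" using H[OF W(1)] H[OF W(2)] by simp
    moreover have "W \<subseteq> Q" "W' \<subseteq> Q" using W by auto
    ultimately show "W = W'" using Q(2) by blast
  qed
  moreover have "H ` ?P \<subseteq> ?S" using H by blast
  moreover have "finite ?S" using finite_copies[OF G, of F] by simp
  ultimately have "card ?P \<le> card ?S" by (rule card_inj_on_le)
  then show ?thesis using Q by (simp add: n_subsets)
qed

subsection \<open>Walks and diameter\<close>

lemma walk_len_0: "walk_len G 0 u v \<longleftrightarrow> u = v \<and> u \<in> verts G"
  unfolding walk_len_def by (auto simp: length_Suc_conv intro: exI[of _ "[u]"])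

lemma walk_len_Suc:
  "walk_len G (Suc n) u v \<longleftrightarrow> u \<in> verts G \<and> (\<exists>w. {u, w} \<in> edges G \<and> walk_len G n w v)"
proof
  assume "walk_len G (Suc n) u v"
  then obtain p where p: "length p = Suc (Suc n)" "hd p = u" "last p = v" "set p \<subseteq> verts G"
    "\<forall>i<Suc n. {p ! i, p ! Suc i} \<in> edges G" unfolding walk_len_def by blast
  then obtain q where q: "p = u # q" "length q = Suc n" by (cases p) auto
  have "walk_len G n (hd q) v"
    unfolding walk_len_def using p q by (intro exI[of _ q]) (auto split: if_splits)
  moreover have "{u, hd q} \<in> edges G" using p(5) q by (cases q) auto
  ultimately show "u \<in> verts G \<and> (\<exists>w. {u, w} \<in> edges G \<and> walk_len G n w v)"
    using p q by auto
next
  assume "u \<in> verts G \<and> (\<exists>w. {u, w} \<in> edges G \<and> walk_len G n w v)"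
  then obtain w q where q: "u \<in> verts G" "{u, w} \<in> edges G" "length q = Suc n" "hd q = w"
    "last q = v" "set q \<subseteq> verts G" "\<forall>i<n. {q ! i, q ! Suc i} \<in> edges G"
    unfolding walk_len_def by blast
  have "{(u # q) ! i, (u # q) ! Suc i} \<in> edges G" if "i < Suc n" for i
    using q that by (cases i; cases q) auto
  then show "walk_len G (Suc n) u v"
    unfolding walk_len_def using q by (intro exI[of _ "u # q"]) auto
qed

lemma finite_gdist_set:
  assumes "is_graph G"
  shows "finite {gdist G u v | u v. u \<in> verts G \<and> v \<in> verts G}"
proof -
  have "{gdist G u v | u v. u \<in> verts G \<and> v \<in> verts G}
      = (\<lambda>(u, v). gdist G u v) ` (verts G \<times> verts G)" by auto
  then show ?thesis using assms by (simp add: is_graph_def)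
qed

text \<open>The upper half of diameter 2: distances are at most 2, and lengths 0 and 1 are excluded
  for distinct non-adjacent vertices.\<close>

lemma diameter_two_common_neighbour:
  assumes F: "is_graph F" "has_diameter F 2" and uv: "u \<in> verts F" "v \<in> verts F" "u \<noteq> v"
    "{u, v} \<notin> edges F"
  shows "\<exists>w. {u, w} \<in> edges F \<and> {w, v} \<in> edges F"
proof -
  have "gdist F u v \<le> Max {gdist F u v | u v. u \<in> verts F \<and> v \<in> verts F}"
    using uv by (intro Max_ge finite_gdist_set[OF F(1)]) blast
  then have "gdist F u v \<le> 2" using F(2) by (simp add: has_diameter_def)
  moreover have "walk_len F (gdist F u v) u v"
    using F uv LeastI_ex[of "\<lambda>n. walk_len F n u v"]
    by (simp add: has_diameter_def connected_graph_def gdist_def)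
  ultimately obtain n where "n \<le> 2" "walk_len F n u v" by blast
  then have "walk_len F 0 u v \<or> walk_len F (Suc 0) u v \<or> walk_len F (Suc (Suc 0)) u v"
    by (metis One_nat_def Suc_1 le_Suc_eq le_zero_eq)
  then show ?thesis using uv by (auto simp: walk_len_0 walk_len_Suc)
qed

text \<open>The lower half of diameter 2: a pair attaining the maximum has neither a walk of length
  0 nor one of length 1.\<close>

lemma diameter_two_nonadjacent:
  assumes F: "is_graph F" "has_diameter F 2"
  shows "\<exists>u\<in>verts F. \<exists>v\<in>verts F. u \<noteq> v \<and> {u, v} \<notin> edges F"
proof -
  let ?S = "{gdist F u v | u v. u \<in> verts F \<and> v \<in> verts F}"
  have "verts F \<noteq> {}" using F by (auto simp: is_graph_def)
  then have "Max ?S \<in> ?S" using finite_gdist_set[OF F(1)] by (intro Max_in) auto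
  then obtain u v where uv: "u \<in> verts F" "v \<in> verts F" "gdist F u v = 2"
    using F unfolding has_diameter_def by auto
  have "\<not> walk_len F n u v" if "n < 2" for n
    using not_less_Least[of n "\<lambda>n. walk_len F n u v"] that uv(3) by (simp add: gdist_def)
  then have "\<not> walk_len F 0 u v" "\<not> walk_len F (Suc 0) u v" by auto
  then show ?thesis using uv by (auto simp: walk_len_0 walk_len_Suc)
qed

lemma has_diameterI:
  assumes G: "is_graph G"
    and le: "\<And>u v. u \<in> verts G \<Longrightarrow> v \<in> verts G \<Longrightarrow> \<exists>m\<le>d. walk_len G m u v"
    and xy: "x \<in> verts G" "y \<in> verts G" "\<And>m. m < d \<Longrightarrow> \<not> walk_len G m x y"
  shows "has_diameter G d"
proof -
  have dist: "gdist G u v \<le> d" if "u \<in> verts G" "v \<in> verts G" for u v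
    using le[OF that] Least_le[of "\<lambda>n. walk_len G n u v"] unfolding gdist_def
    by (meson order_trans)
  have "walk_len G (gdist G x y) x y"
    using le[OF xy(1,2)] LeastI_ex[of "\<lambda>n. walk_len G n x y"] by (auto simp: gdist_def)
  then have "gdist G x y = d"
    using xy(3) dist[OF xy(1,2)] by (metis le_neq_implies_less)
  then have "Max {gdist G u v | u v. u \<in> verts G \<and> v \<in> verts G} = d"
    using dist xy finite_gdist_set[OF G] by (intro Max_eqI) auto
  then show ?thesis
    using le unfolding has_diameter_def connected_graph_def by blast
qed

text \<open>The right side grows like n^r, the left like n^(r-1). The left side has the form of the
  upper bounds for copies, 2n + 1 being the order of the host; n div 4 is the guaranteed size of the
  cliques in which copies are built.\<close>

lemma power_lt_choose_quarter:
  assumes "r \<ge> 1"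
  shows "\<exists>n0. \<forall>n\<ge>n0. C * (2 * n + 1) ^ (r - 1) < (n div 4) choose r"
proof -
  \<comment> \<open>The first bound lets one factor n outweigh all constants, after 2n + 1 \<le> 3n
    and multiplication by (8r)^r. The second gives n \<le> 8 (n div 4) and r \<le> n div 4, the
    latter for the lower bound ((n div 4) / r)^r on the binomial coefficient.\<close>
  let ?n0 = "max (C * 3 ^ (r - 1) * (8 * r) ^ r + 1) (8 * r + 8)"
  have "C * (2 * n + 1) ^ (r - 1) < (n div 4) choose r" if n: "n \<ge> ?n0" for n
  proof -
    have "C * (2 * n + 1) ^ (r - 1) * (8 * r) ^ r \<le> C * (3 * n) ^ (r - 1) * (8 * r) ^ r"
      using n by (intro mult_mono power_mono) auto
    also have "\<dots> = (C * 3 ^ (r - 1) * (8 * r) ^ r) * n ^ (r - 1)"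
      by (simp add: power_mult_distrib)
    also have "\<dots> < n * n ^ (r - 1)"
      using n by (intro mult_strict_right_mono) auto
    also have "\<dots> = n ^ r" using assms by (cases r) auto
    also have "\<dots> \<le> (8 * (n div 4)) ^ r" using n by (intro power_mono) auto
    also have "\<dots> = 8 ^ r * (n div 4) ^ r" by (simp add: power_mult_distrib)
    also have "(n div 4) ^ r \<le> ((n div 4) choose r) * r ^ r"
    proof -
      have "(real (n div 4) / real r) ^ r \<le> real ((n div 4) choose r)"
        using n by (intro binomial_ge_n_over_k_pow_k) auto
      then have "real (n div 4) ^ r \<le> real ((n div 4) choose r) * real r ^ r"
        using assms by (simp add: power_divide divide_le_eq)
      then show ?thesis by (metis of_nat_le_iff of_nat_mult of_nat_power)
    qed
    finally have "C * (2 * n + 1) ^ (r - 1) * (8 * r) ^ r < ((n div 4) choose r) * (8 * r) ^ r"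
      by (simp add: power_mult_distrib mult_ac)
    then show ?thesis by simp
  qed
  then show ?thesis by blast
qed

section \<open>Moving copies by vertex maps\<close>

lemma graph_image_involution_edge_iff:
  assumes "\<And>x. \<phi> (\<phi> x) = x"
  shows "{x, y} \<in> edges (graph_image \<phi> H) \<longleftrightarrow> {\<phi> x, \<phi> y} \<in> edges H"
proof -
  have inv: "\<phi> ` \<phi> ` e = e" for e using assms by (simp add: image_image)
  show ?thesis
  proof
    assume "{x, y} \<in> edges (graph_image \<phi> H)"
    then obtain e where "e \<in> edges H" "{x, y} = \<phi> ` e" by auto
    moreover have "\<phi> ` {x, y} = {\<phi> x, \<phi> y}" by simp
    ultimately show "{\<phi> x, \<phi> y} \<in> edges H" using inv by metis
  next
    assume "{\<phi> x, \<phi> y} \<in> edges H"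
    then have "\<phi> ` {\<phi> x, \<phi> y} \<in> edges (graph_image \<phi> H)" by (simp del: image_insert)
    then show "{x, y} \<in> edges (graph_image \<phi> H)" using assms by simp
  qed
qed

text \<open>The scheme behind the exchange arguments: \<open>A\<close> is mapped injectively into
  \<open>S\<close>, and \<open>X\<close> is a part of \<open>S\<close> that the image misses. The
  choice of \<open>X\<close> decides what is gained: nothing, one copy, the whole gap, or a family
  inside the gap.\<close>

lemma card_add_le_by_graph_image:
  assumes "inj \<phi>" "finite S" "\<And>H. H \<in> A \<Longrightarrow> graph_image \<phi> H \<in> S" "X \<subseteq> S"
    and "\<And>H. H \<in> A \<Longrightarrow> graph_image \<phi> H \<notin> X"
  shows "card A + card X \<le> card S"
proof -
  let ?I = "graph_image \<phi> ` A"
  have "card ?I = card A"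
    using inj_graph_image[OF assms(1)] by (intro card_image) (rule inj_on_subset, auto)
  moreover have I: "?I \<subseteq> S" "?I \<inter> X = {}" using assms by blast+
  moreover have "card (?I \<union> X) = card ?I + card X"
    using I assms(2,4) by (intro card_Un_disjoint) (blast intro: finite_subset)+
  moreover have "card (?I \<union> X) \<le> card S"
    using I assms(2,4) by (intro card_mono) blast+
  ultimately show ?thesis by simp
qed

text \<open>Adjacency is measured in the copy, not in the host, so the common neighbour and both of
  its edges belong to \<open>H\<close> itself.\<close>

lemma copy_common_neighbour:
  assumes F: "is_graph F" "has_diameter F 2" and H: "H \<in> copies F G"
    and uv: "u \<in> verts H" "v \<in> verts H" "u \<noteq> v" "{u, v} \<notin> edges H"
  shows "\<exists>w. {u, w} \<in> edges H \<and> {w, v} \<in> edges H"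
proof -
  obtain f where f: "inj_on f (verts F)" "H = graph_image f F"
    using H copies_iff[OF F(1)] by blast
  then obtain x y where xy: "x \<in> verts F" "y \<in> verts F" "u = f x" "v = f y" using uv by auto
  have fe: "{f p, f q} \<in> edges H" if "{p, q} \<in> edges F" for p q
  proof -
    have "f ` {p, q} \<in> edges H" using that f(2) by (simp del: image_insert)
    then show ?thesis by simp
  qed
  have "{x, y} \<notin> edges F" using fe uv(4) xy by blast
  then obtain w where "{x, w} \<in> edges F" "{w, y} \<in> edges F"
    using diameter_two_common_neighbour[OF F] xy uv(3) by blast
  then show ?thesis using fe xy by blast
qed

subsection \<open>The host graph\<close>

definition av :: "nat \<Rightarrow> nat" where "av i = 2 * i + 2"
definition bv :: "nat \<Rightarrow> nat" where "bv i = 2 * i + 1"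

lemma av_bv_simps [simp]:
  "av i = av j \<longleftrightarrow> i = j" "bv i = bv j \<longleftrightarrow> i = j" "av i \<noteq> bv j" "bv j \<noteq> av i"
  "av i \<noteq> 0" "0 \<noteq> av i" "bv i \<noteq> 0" "0 \<noteq> bv i"
  "0 < av i" "0 < bv i"
  by (auto simp: av_def bv_def) presburger+

lemma inj_av: "inj_on av A" and inj_bv: "inj_on bv A"
  by (simp_all add: inj_on_def)

text \<open>The vertices are numbered so that the $F$-degree increases with the number: $z = 0$,
  $b_i = 2i + 1$, $a_i = 2i + 2$.\<close>

definition irr_graph :: "nat \<Rightarrow> nat \<Rightarrow> nat ugraph" where
  "irr_graph n k = ({..2 * n},
     {{av i, av j} | i j. i < n \<and> j < n \<and> i \<noteq> j} \<union>
     {{bv i, bv j} | i j. i < n \<and> j < n \<and> i \<noteq> j} \<union>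
     {{av i, bv j} | i j. i < n \<and> j < n \<and> n \<le> i + j} \<union>
     {{0, av i} | i. i < n \<and> i < k})"

lemma verts_irr_graph: "verts (irr_graph n k) = {..2 * n}"
  by (simp add: irr_graph_def verts_def)

lemma verts_irr_graph_simps [simp]:
  "0 \<in> verts (irr_graph n k)"
  "av i \<in> verts (irr_graph n k) \<longleftrightarrow> i < n"
  "bv i \<in> verts (irr_graph n k) \<longleftrightarrow> i < n"
  by (auto simp: verts_irr_graph av_def bv_def)

lemma card_verts_irr_graph [simp]: "card (verts (irr_graph n k)) = 2 * n + 1"
  by (simp add: verts_irr_graph)

lemma verts_irr_graph_cases:
  assumes "v \<in> verts (irr_graph n k)"
  obtains "v = 0" | i where "i < n" "v = av i" | i where "i < n" "v = bv i"
proof (cases "v = 0")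
  case False
  show ?thesis
  proof (cases "even v")
    case True
    then obtain m where m: "v = 2 * m" by blast
    have "m - 1 < n \<and> v = av (m - 1)"
      using assms False m by (auto simp: verts_irr_graph av_def)
    then show ?thesis using that by blast
  next
    case False
    then obtain m where "v = 2 * m + 1" by (rule oddE)
    then have "m < n \<and> v = bv m"
      using assms by (auto simp: verts_irr_graph bv_def)
    then show ?thesis using that by blast
  qed
qed

lemma edges_irr_graph_simps [simp]:
  "{av i, av j} \<in> edges (irr_graph n k) \<longleftrightarrow> i < n \<and> j < n \<and> i \<noteq> j"
  "{bv i, bv j} \<in> edges (irr_graph n k) \<longleftrightarrow> i < n \<and> j < n \<and> i \<noteq> j"
  "{av i, bv j} \<in> edges (irr_graph n k) \<longleftrightarrow> i < n \<and> j < n \<and> n \<le> i + j"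
  "{bv j, av i} \<in> edges (irr_graph n k) \<longleftrightarrow> i < n \<and> j < n \<and> n \<le> i + j"
  "{0, av i} \<in> edges (irr_graph n k) \<longleftrightarrow> i < n \<and> i < k"
  "{av i, 0} \<in> edges (irr_graph n k) \<longleftrightarrow> i < n \<and> i < k"
  "{0, bv i} \<notin> edges (irr_graph n k)"
  "{bv i, 0} \<notin> edges (irr_graph n k)"
  by (auto simp: irr_graph_def edges_def doubleton_eq_iff)

lemma is_graph_irr_graph:
  assumes "n \<ge> 1"
  shows "is_graph (irr_graph n k)"
proof -
  have "\<exists>x y. x \<noteq> y \<and> e = {x, y} \<and> x \<in> verts (irr_graph n k) \<and> y \<in> verts (irr_graph n k)"
    if e: "e \<in> edges (irr_graph n k)" for e
  proof -
    have "(\<exists>i j. i < n \<and> j < n \<and> i \<noteq> j \<and> e = {av i, av j}) \<or>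
      (\<exists>i j. i < n \<and> j < n \<and> i \<noteq> j \<and> e = {bv i, bv j}) \<or>
      (\<exists>i j. i < n \<and> j < n \<and> e = {av i, bv j}) \<or> (\<exists>i. i < n \<and> e = {0, av i})"
      using e unfolding irr_graph_def edges_def by simp blast
    then show ?thesis
    proof (elim disjE exE conjE)
      fix i j assume "i < n" "j < n" "i \<noteq> j" "e = {av i, av j}"
      then show ?thesis by (intro exI[of _ "av i"] exI[of _ "av j"]) simp
    next
      fix i j assume "i < n" "j < n" "i \<noteq> j" "e = {bv i, bv j}"
      then show ?thesis by (intro exI[of _ "bv i"] exI[of _ "bv j"]) simp
    next
      fix i j assume "i < n" "j < n" "e = {av i, bv j}"
      then show ?thesis by (intro exI[of _ "av i"] exI[of _ "bv j"]) simp
    next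
      fix i assume "i < n" "e = {0, av i}"
      then show ?thesis by (intro exI[of _ 0] exI[of _ "av i"]) simp
    qed
  qed
  then show ?thesis
    using assms by (simp add: is_graph_def verts_irr_graph)
qed

lemma irr_graph_neighbour_0:
  assumes "n \<ge> 1" "{0, w} \<in> edges (irr_graph n k)"
  obtains i where "w = av i" "i < n" "i < k"
proof -
  have "w \<in> verts (irr_graph n k)"
    using edge_subset_verts[OF is_graph_irr_graph[OF assms(1)] assms(2)] by simp
  moreover have "w \<noteq> 0"
    using edge_endpoints_distinct[OF is_graph_irr_graph[OF assms(1)] assms(2)] by simp
  ultimately show ?thesis
    using assms(2) that by (elim verts_irr_graph_cases) auto
qed

text \<open>The adjacent vertices \<open>av 1\<close> and \<open>bv (n - 1)\<close> serve as hubs: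
  \<open>av 1\<close> is joined to \<open>0\<close> and to every other \<open>av i\<close>, and
  \<open>bv (n - 1)\<close> to every other \<open>bv i\<close>. The pair \<open>0\<close>,
  \<open>bv 0\<close> attains the distance 3.\<close>

lemma has_diameter_irr_graph:
  assumes n: "n \<ge> 2" and k: "k \<ge> 2"
  shows "has_diameter (irr_graph n k) 3"
proof -
  let ?G = "irr_graph n k"
  have G: "is_graph ?G" using n is_graph_irr_graph by simp
  have step: "walk_len ?G m w v \<Longrightarrow> {u, w} \<in> edges ?G \<Longrightarrow> walk_len ?G (Suc m) u v" for m u v w
    using edge_subset_verts[OF G] by (auto simp: walk_len_Suc)
  \<comment> \<open>Consecutive entries may coincide, so walks of every length up to 3 share this
    one shape.\<close>
  have walk_via: "\<exists>m\<le>3. walk_len ?G m u v" if w: "w0 = u" "w3 = v" "u \<in> verts ?G" "v \<in> verts ?G"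
    "{w0, w1} \<in> edges ?G \<or> w0 = w1" "{w1, w2} \<in> edges ?G \<or> w1 = w2" "{w2, w3} \<in> edges ?G \<or> w2 = w3"
    for u v w0 w1 w2 w3
  proof -
    have "walk_len ?G 0 w3 v" using w by (simp add: walk_len_0)
    then have "\<exists>m\<le>1. walk_len ?G m w2 v" using w(7) step by (metis One_nat_def le_refl zero_le)
    then have "\<exists>m\<le>2. walk_len ?G m w1 v" using w(6) step
      by (metis One_nat_def Suc_1 Suc_le_mono le_SucI)
    then have "\<exists>m\<le>3. walk_len ?G m w0 v" using w(5) step
      by (metis Suc_le_mono le_SucI numeral_3_eq_3 numeral_2_eq_2)
    then show ?thesis using w by simp
  qed
  show ?thesis
  proof (rule has_diameterI[OF G, of 3 0 "bv 0"])
    fix u v assume uv: "u \<in> verts ?G" "v \<in> verts ?G"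
    show "\<exists>m\<le>3. walk_len ?G m u v"
      using uv(1)
    proof (cases rule: verts_irr_graph_cases)
      case 1
      show ?thesis using uv(2)
      proof (cases rule: verts_irr_graph_cases)
        case 1
        then show ?thesis using \<open>u = 0\<close> walk_via[of 0 u 0 v 0 0] uv by simp
      next
        case (2 i)
        then show ?thesis using \<open>u = 0\<close> walk_via[of 0 u "av i" v "av 1" "av i"] uv n k by auto
      next
        case (3 i)
        then show ?thesis using \<open>u = 0\<close> walk_via[of 0 u "bv i" v "av 1" "bv (n - 1)"] uv n k by auto
      qed
    next
      case u: (2 i)
      show ?thesis using uv(2)
      proof (cases rule: verts_irr_graph_cases)
        case 1
        then show ?thesis using u walk_via[of "av i" u 0 v "av 1" "av 1"] uv n k by auto
      next
        case (2 j)
        then show ?thesis using u walk_via[of "av i" u "av j" v "av i" "av i"] uv n k by auto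
      next
        case (3 j)
        then show ?thesis using u walk_via[of "av i" u "bv j" v "av 1" "bv (n - 1)"] uv n k by auto
      qed
    next
      case u: (3 i)
      show ?thesis using uv(2)
      proof (cases rule: verts_irr_graph_cases)
        case 1
        then show ?thesis using u walk_via[of "bv i" u 0 v "bv (n - 1)" "av 1"] uv n k by auto
      next
        case (2 j)
        then show ?thesis using u walk_via[of "bv i" u "av j" v "bv (n - 1)" "av 1"] uv n k by auto
      next
        case (3 j)
        then show ?thesis using u walk_via[of "bv i" u "bv j" v "bv i" "bv i"] uv n k by auto
      qed
    qed
  next
    show "0 \<in> verts ?G" "bv 0 \<in> verts ?G" using n by auto
    fix m :: nat assume "m < 3"
    then consider "m = 0" | "m = Suc 0" | "m = Suc (Suc 0)" by linarith
    then show "\<not> walk_len ?G m 0 (bv 0)"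
    proof cases
      case 3
      \<comment> \<open>All neighbours of \<open>0\<close> are of the form \<open>av i\<close> with
        i < n, while \<open>bv 0\<close> could be adjacent to \<open>av i\<close> only for n \<le>
        i.\<close>
      have "\<not> ({0, w} \<in> edges ?G \<and> {w, bv 0} \<in> edges ?G)" for w
        using irr_graph_neighbour_0[of n w k] n by force
      then show ?thesis using 3 by (auto simp: walk_len_0 walk_len_Suc)
    qed (auto simp: walk_len_0 walk_len_Suc)
  qed
qed

subsection \<open>Comparing degrees\<close>

definition flip :: "nat \<Rightarrow> nat" where
  "flip x = (if x = 0 then 0 else if odd x then x + 1 else x - 1)"

lemma flip_simps [simp]: "flip 0 = 0" "flip (av i) = bv i" "flip (bv i) = av i"
  by (simp_all add: flip_def av_def bv_def)

lemma flip_flip [simp]: "flip (flip x) = x"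
  by (auto simp: flip_def)

lemma card_Collect_split:
  assumes "finite C"
  shows "card {H \<in> C. P H} = card {H \<in> C. P H \<and> Q H} + card {H \<in> C. P H \<and> \<not> Q H}"
proof -
  have "{H \<in> C. P H} = {H \<in> C. P H \<and> Q H} \<union> {H \<in> C. P H \<and> \<not> Q H}" by blast
  moreover have "card ({H \<in> C. P H \<and> Q H} \<union> {H \<in> C. P H \<and> \<not> Q H})
      = card {H \<in> C. P H \<and> Q H} + card {H \<in> C. P H \<and> \<not> Q H}"
    using assms by (intro card_Un_disjoint) (simp, simp, blast)
  ultimately show ?thesis by simp
qed

text \<open>The bound on \<open>n\<close> separates the first k indices from the last k and ensures
  that the cliques chosen below have at least n div 4 vertices.\<close>

locale irr_setting =
  fixes F :: "'b ugraph" and k n :: nat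
  assumes graph_F: "is_graph F" and diam_F: "has_diameter F 2"
    and k_def: "k = card (verts F)" and n_ge: "n \<ge> 4 * k + 8"
begin

abbreviation G :: "nat ugraph" where "G \<equiv> irr_graph n k"
abbreviation Cp :: "nat ugraph set" where "Cp \<equiv> copies F G"

lemma graph_G: "is_graph G"
  using n_ge by (intro is_graph_irr_graph) simp

lemma finite_Cp: "finite {H \<in> Cp. P H}"
  using finite_copies[OF graph_G, of F] by simp

lemma edge_in_G: "H \<in> Cp \<Longrightarrow> {x, y} \<in> edges H \<Longrightarrow> {x, y} \<in> edges G"
  using copiesD(3) by blast

lemma edge_verts: "H \<in> Cp \<Longrightarrow> {x, y} \<in> edges H \<Longrightarrow> x \<in> verts H \<and> y \<in> verts H"
  using edge_subset_verts[OF copiesD(1)] by blast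

lemma vert_in_G: "H \<in> Cp \<Longrightarrow> x \<in> verts H \<Longrightarrow> x \<in> verts G"
  using copiesD(2) by blast

text \<open>An induced path with middle vertex \<open>w\<close>. Its non-adjacent ends allow one
  copy to contain both \<open>0\<close> and a vertex \<open>av i\<close> that is not a neighbour of
  \<open>0\<close>.\<close>

lemma path_in_F:
  obtains x y w where "x \<in> verts F" "y \<in> verts F" "w \<in> verts F" "x \<noteq> y" "x \<noteq> w" "y \<noteq> w"
    "{x, y} \<notin> edges F" "{x, w} \<in> edges F" "{w, y} \<in> edges F"
proof -
  obtain x y where xy: "x \<in> verts F" "y \<in> verts F" "x \<noteq> y" "{x, y} \<notin> edges F"
    using diameter_two_nonadjacent[OF graph_F diam_F] by blast
  then obtain w where w: "{x, w} \<in> edges F" "{w, y} \<in> edges F"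
    using diameter_two_common_neighbour[OF graph_F diam_F] by blast
  have "w \<in> verts F" "x \<noteq> w" "y \<noteq> w"
    using w edge_subset_verts[OF graph_F] edge_endpoints_distinct[OF graph_F] by blast+
  then show ?thesis using that xy w by blast
qed

lemma k_ge_3: "k \<ge> 3"
proof -
  obtain x y w where "x \<in> verts F" "y \<in> verts F" "w \<in> verts F" "x \<noteq> y" "x \<noteq> w" "y \<noteq> w"
    using path_in_F by metis
  then have "card {x, y, w} = 3" "{x, y, w} \<subseteq> verts F" by auto
  then show ?thesis using k_def graph_F card_mono by (metis is_graph_def)
qed

text \<open>Within the copy, \<open>v\<close> is a neighbour of \<open>0\<close> or has a common
  neighbour with it, and in the host \<open>0\<close> has only the neighbours \<open>av j\<close>
  with j < k. Hence every copy through \<open>0\<close> also contains one of k fixed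
  vertices.\<close>

lemma copy_neighbour_0:
  assumes H: "H \<in> Cp" and v: "0 \<in> verts H" "v \<in> verts H" "v \<noteq> 0"
  obtains j where "j < k" "{0, av j} \<in> edges H" "v = av j \<or> {av j, v} \<in> edges H"
proof -
  obtain w where w: "{0, w} \<in> edges H" "v = w \<or> {w, v} \<in> edges H"
    using copy_common_neighbour[OF graph_F diam_F H v(1,2)] v(3) by metis
  moreover have "n \<ge> 1" using n_ge by simp
  ultimately obtain j where "w = av j" "j < k"
    using irr_graph_neighbour_0[of n w k] edge_in_G[OF H] by metis
  then show ?thesis using that w by blast
qed

lemma copy_0_bv:
  assumes H: "H \<in> Cp" "0 \<in> verts H" "bv l \<in> verts H"
  shows "n < k + l"
proof -
  obtain j where j: "j < k" "bv l = av j \<or> {av j, bv l} \<in> edges H"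
    using copy_neighbour_0[OF H(1,2,3)] by (metis av_bv_simps(7))
  then have "n \<le> j + l" using edge_in_G[OF H(1), of "av j" "bv l"] by simp
  then show ?thesis using j by simp
qed

section \<open>Degrees split by whether a copy passes through \<open>0\<close>\<close>

definition deg_off :: "nat \<Rightarrow> nat" where
  "deg_off v = card {H \<in> Cp. 0 \<notin> verts H \<and> v \<in> verts H}"

definition deg_on :: "nat \<Rightarrow> nat" where
  "deg_on v = card {H \<in> Cp. 0 \<in> verts H \<and> v \<in> verts H}"

lemma F_degree_split: "F_degree F G v = deg_off v + deg_on v"
proof -
  have "card {H \<in> Cp. v \<in> verts H}
    = card {H \<in> Cp. v \<in> verts H \<and> 0 \<in> verts H} + card {H \<in> Cp. v \<in> verts H \<and> 0 \<notin> verts H}"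
    by (rule card_Collect_split) (rule finite_copies[OF graph_G])
  then show ?thesis
    by (simp add: F_degree_eq deg_off_def deg_on_def conj_commute)
qed

text \<open>\<open>flip\<close> violates only edges at \<open>0\<close>, since the condition n \<le>
  i + j is symmetric. It is an involution, so using the inequality twice yields equality.\<close>

lemma deg_off_flip_le: "deg_off v \<le> deg_off (flip v)"
proof -
  have "card {H \<in> Cp. 0 \<notin> verts H \<and> v \<in> verts H} + card ({} :: nat ugraph set)
      \<le> card {H \<in> Cp. 0 \<notin> verts H \<and> flip v \<in> verts H}"
  proof (rule card_add_le_by_graph_image[of flip])
    show inj: "inj flip" by (metis flip_flip injI)
    fix H assume "H \<in> {H \<in> Cp. 0 \<notin> verts H \<and> v \<in> verts H}"
    then have H: "H \<in> Cp" "0 \<notin> verts H" "v \<in> verts H" by auto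
    have V: "flip x \<in> verts G" if "x \<in> verts H" for x
      using vert_in_G[OF H(1) that] by (cases rule: verts_irr_graph_cases) auto
    have E: "{flip x, flip y} \<in> edges G" if e: "{x, y} \<in> edges H" for x y
    proof -
      have xy: "x \<in> verts G" "y \<in> verts G" "x \<noteq> 0" "y \<noteq> 0" "{x, y} \<in> edges G"
        using e edge_verts[OF H(1) e] H(2) vert_in_G[OF H(1)] edge_in_G[OF H(1)]
        by (blast, blast, metis, metis, blast)
      then show ?thesis
        by (elim verts_irr_graph_cases) (simp_all add: add.commute)
    qed
    have "graph_image flip H \<in> Cp"
      using graph_image_copy[OF graph_F H(1) inj_on_subset[OF inj subset_UNIV]] V E by blast
    moreover have "0 \<notin> flip ` verts H" using H(2) by (metis flip_flip flip_simps(1) imageE)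
    ultimately show "graph_image flip H \<in> {H \<in> Cp. 0 \<notin> verts H \<and> flip v \<in> verts H}"
      using H(3) by simp
  qed (use finite_Cp in auto)
  then show ?thesis by (simp add: deg_off_def)
qed

lemma deg_off_av: "deg_off (av i) = deg_off (bv i)"
  using deg_off_flip_le[of "av i"] deg_off_flip_le[of "bv i"] by simp

text \<open>Supplies the strictness in the tie-break. The induced path x - w - y of \<open>F\<close>
  is placed with x on \<open>0\<close>. If i < k, then w goes to \<open>av i\<close>, and the
  distinguishing edge is the one to \<open>0\<close>; otherwise w goes to \<open>av 0\<close> and y
  to \<open>av i\<close>, and \<open>bv i\<close> is not adjacent to \<open>av 0\<close>. All
  vertices but x land in one clique, so only edges at \<open>0\<close> need care.\<close>

lemma copy_distinguishing_av_bv: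
  assumes i: "i < n"
  obtains H w where "H \<in> Cp" "0 \<in> verts H" "bv i \<notin> verts H" "{av i, w} \<in> edges H"
    "w \<noteq> av i" "w \<noteq> bv i" "{bv i, w} \<notin> edges G"
proof -
  obtain x y w where xyw: "x \<in> verts F" "y \<in> verts F" "w \<in> verts F" "x \<noteq> y" "x \<noteq> w" "y \<noteq> w"
    "{x, y} \<notin> edges F" "{x, w} \<in> edges F" "{w, y} \<in> edges F"
    by (rule path_in_F)
  have "\<exists>g. bij_betw g (verts F) {..<k}"
    using graph_F k_def by (intro finite_same_card_bij) (simp_all add: is_graph_def)
  then obtain g0 where g0: "bij_betw g0 (verts F) {..<k}" by blast
  define j where "j = (if i < k then i else 0)"
  have jk: "j < k" using k_ge_3 by (simp add: j_def)
  \<comment> \<open>The transposition makes \<open>g\<close> send w to \<open>j\<close> while the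
    indices used remain those below k.\<close>
  define g where "g = transpose (g0 w) j \<circ> g0"
  have gw: "g w = j" by (simp add: g_def)
  have ginj: "inj_on g (verts F)"
    using g0 by (simp add: g_def bij_betw_def comp_inj_on inj_on_subset[OF inj_transpose])
  have gk: "g u < k" if "u \<in> verts F" for u
    using bij_betwE[OF g0] that xyw(3) jk by (auto simp: g_def transpose_def)
  \<comment> \<open>Images \<open>av (g u)\<close> are neighbours of \<open>0\<close>. The one
    exception, y for k \<le> i, is not adjacent to x, so its image need not be adjacent to
    \<open>0\<close>.\<close>
  define f where "f u = (if u = x then 0 else if u = y \<and> k \<le> i then av i else av (g u))" for u
  have finj: "inj_on f (verts F)"
  proof (rule inj_onI)
    fix u v assume uv: "u \<in> verts F" "v \<in> verts F" "f u = f v"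
    then show "u = v"
      using gk[of u] gk[of v] inj_onD[OF ginj _ uv(1,2)] by (auto simp: f_def split: if_splits)
  qed
  have fV: "f u \<in> verts G" if "u \<in> verts F" for u
    using i gk[OF that] n_ge by (auto simp: f_def)
  have fx: "{f x, f v} \<in> edges G" if "{x, v} \<in> edges F" for v
  proof -
    have "v \<in> verts F" "v \<noteq> x" "v \<noteq> y"
      using that xyw(7) edge_subset_verts[OF graph_F that] edge_endpoints_distinct[OF graph_F that]
      by auto
    then show ?thesis using gk[of v] n_ge by (simp add: f_def)
  qed
  have fE: "{f u, f v} \<in> edges G" if e: "{u, v} \<in> edges F" for u v
  proof -
    have uv: "u \<in> verts F" "v \<in> verts F" "u \<noteq> v"
      using edge_subset_verts[OF graph_F e] edge_endpoints_distinct[OF graph_F e] by auto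
    consider "u = x" | "v = x" | "u \<noteq> x" "v \<noteq> x" by blast
    then show ?thesis
    proof cases
      case 1
      then show ?thesis using fx e by simp
    next
      case 2
      then show ?thesis using fx[of u] e by (simp add: insert_commute)
    next
      case 3
      have "f u \<noteq> f v" using finj uv by (auto dest: inj_onD)
      moreover have "\<exists>p. f r = av p" if "r \<noteq> x" for r using that by (simp add: f_def)
      then obtain p q where "f u = av p" "f v = av q" using 3 by blast
      ultimately show ?thesis using fV[OF uv(1)] fV[OF uv(2)] by simp
    qed
  qed
  let ?H = "graph_image f F"
  have "edges ?H \<subseteq> edges G"
  proof
    fix e assume "e \<in> edges ?H"
    then obtain c where "c \<in> edges F" "e = f ` c" by auto
    then show "e \<in> edges G" using edge_doubletonE[OF graph_F] fE by (metis image_empty image_insert)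
  qed
  then have Hc: "?H \<in> Cp"
    unfolding copies_iff[OF graph_F] using finj fV by (intro exI[of _ f]) auto
  have He: "{f u, f v} \<in> edges ?H" if "{u, v} \<in> edges F" for u v
  proof -
    have "f ` {u, v} \<in> edges ?H" using that by (simp del: image_insert)
    then show ?thesis by simp
  qed
  have fx0: "f x = 0" and fw: "f w = av j" using xyw gw by (simp_all add: f_def)
  have H0: "0 \<in> verts ?H" using fx0 xyw(1) by (metis imageI verts_graph_image)
  have Hb: "bv i \<notin> verts ?H" by (auto simp: f_def split: if_splits)
  show ?thesis
  proof (cases "i < k")
    case True
    then have "{av i, 0} \<in> edges ?H"
      using He[OF xyw(8)] fx0 fw by (simp add: j_def insert_commute)
    then show ?thesis using that[OF Hc H0 Hb] by simp
  next
    case False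
    then have "{av i, av 0} \<in> edges ?H"
      using He[OF xyw(9)] fw xyw(4) by (simp add: j_def f_def insert_commute)
    moreover have "i \<noteq> 0" using False k_ge_3 by simp
    moreover have "{bv i, av 0} \<notin> edges G" using i by simp
    ultimately show ?thesis using that[OF Hc H0 Hb, of "av 0"] by simp
  qed
qed

text \<open>Copies containing both vertices cancel. In a copy through \<open>0\<close> with
  \<open>bv i\<close> but without \<open>av i\<close>, every neighbour of \<open>bv i\<close> is
  adjacent to \<open>av i\<close> in the host, so exchanging the two gives a copy. The image is
  never \<open>H0\<close>: its edge from \<open>av i\<close> to \<open>w\<close> would come from an
  edge between \<open>bv i\<close> and \<open>w\<close>, which the host lacks.\<close>

lemma deg_on_bv_less_av:
  assumes i: "i < n"
  shows "deg_on (bv i) < deg_on (av i)"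
proof -
  let ?\<phi> = "transpose (av i) (bv i)"
  let ?A = "{H \<in> Cp. (0 \<in> verts H \<and> bv i \<in> verts H) \<and> av i \<notin> verts H}"
  let ?S = "{H \<in> Cp. (0 \<in> verts H \<and> av i \<in> verts H) \<and> bv i \<notin> verts H}"
  let ?B = "{H \<in> Cp. 0 \<in> verts H \<and> av i \<in> verts H \<and> bv i \<in> verts H}"
  obtain H0 w where H0: "H0 \<in> Cp" "0 \<in> verts H0" "bv i \<notin> verts H0" "{av i, w} \<in> edges H0"
    "w \<noteq> av i" "w \<noteq> bv i" "{bv i, w} \<notin> edges G"
    using copy_distinguishing_av_bv[OF i] by metis
  have "card ?A + card {H0} \<le> card ?S"
  proof (rule card_add_le_by_graph_image[of ?\<phi>])
    show inj: "inj ?\<phi>" by simp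
    show "finite ?S" by (rule finite_Cp)
    show "{H0} \<subseteq> ?S" using H0 edge_verts[OF H0(1,4)] by simp
    fix H assume "H \<in> ?A"
    then have H: "H \<in> Cp" "0 \<in> verts H" "bv i \<in> verts H" "av i \<notin> verts H" by auto
    have V: "?\<phi> x \<in> verts G" if "x \<in> verts H" for x
      using vert_in_G[OF H(1) that] i by (auto simp: transpose_def)
    have Eb: "{av i, y} \<in> edges G" if e: "{bv i, y} \<in> edges H" for y
    proof -
      have y: "y \<in> verts H" "{bv i, y} \<in> edges G" "y \<noteq> av i"
        using e edge_verts[OF H(1) e] H(4) edge_in_G[OF H(1)] by auto
      from vert_in_G[OF H(1) y(1)] show ?thesis
      proof (cases rule: verts_irr_graph_cases)
        case (3 l)
        \<comment> \<open>Both indices exceed n - k, so their sum is at least n and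
          \<open>av i\<close> is adjacent to \<open>bv l\<close>.\<close>
        then have "n < k + l" "n < k + i" using copy_0_bv[OF H(1,2)] y(1) H(3) by auto
        then show ?thesis using 3 i n_ge by simp
      qed (use y i in auto)
    qed
    have E: "{?\<phi> x, ?\<phi> y} \<in> edges G" if e: "{x, y} \<in> edges H" for x y
    proof -
      have xy: "x \<noteq> av i" "y \<noteq> av i" "x \<noteq> y"
        using edge_verts[OF H(1) e] H(4) edge_endpoints_distinct[OF copiesD(1)[OF H(1)] e] by auto
      have e': "{y, x} \<in> edges H" using e by (simp add: insert_commute)
      consider "x = bv i" | "y = bv i" | "x \<noteq> bv i" "y \<noteq> bv i" by blast
      then show ?thesis
      proof cases
        case 1
        then show ?thesis using Eb[of y] e xy by simp
      next
        case 2
        then show ?thesis using Eb[of x] e' xy by (simp add: insert_commute)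
      next
        case 3
        then show ?thesis using edge_in_G[OF H(1) e] xy by simp
      qed
    qed
    have "graph_image ?\<phi> H \<in> Cp"
      using graph_image_copy[OF graph_F H(1) inj_on_subset[OF inj subset_UNIV]] V E by blast
    moreover have "0 \<in> ?\<phi> ` verts H" using H(2) by (intro image_eqI[of _ _ 0]) auto
    moreover have "av i \<in> ?\<phi> ` verts H" using H(3) by (intro image_eqI[of _ _ "bv i"]) auto
    moreover have "bv i \<notin> ?\<phi> ` verts H" using H(4) by (auto simp: transpose_def split: if_splits)
    ultimately show "graph_image ?\<phi> H \<in> ?S" by simp
    show "graph_image ?\<phi> H \<notin> {H0}"
    proof
      assume "graph_image ?\<phi> H \<in> {H0}"
      then have "{av i, w} \<in> edges (graph_image ?\<phi> H)" using H0(4) by simp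
      then have "{bv i, w} \<in> edges H"
        using graph_image_involution_edge_iff[of ?\<phi> "av i" w H] H0(5,6) by simp
      then show False using edge_in_G[OF H(1)] H0(7) by blast
    qed
  qed
  moreover have "deg_on (bv i) = card ?B + card ?A"
    unfolding deg_on_def
    using card_Collect_split[OF finite_copies[OF graph_G, of F],
        of "\<lambda>H. 0 \<in> verts H \<and> bv i \<in> verts H"
          "\<lambda>H. av i \<in> verts H"]
    by (simp add: conj_ac)
  moreover have "deg_on (av i) = card ?B + card ?S"
    unfolding deg_on_def
    using card_Collect_split[OF finite_copies[OF graph_G, of F],
        of "\<lambda>H. 0 \<in> verts H \<and> av i \<in> verts H"
          "\<lambda>H. bv i \<in> verts H"]
    by (simp add: conj_ac)
  ultimately show ?thesis by simp
qed

section \<open>From \<open>bv i\<close> and \<open>av i\<close> to \<open>bv (Suc i)\<close>\<close>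

text \<open>The copies that are lost when \<open>bv (Suc i)\<close> is exchanged for \<open>bv i\<close>: the edge to
  \<open>av (n - 1 - i)\<close> is the only one that distinguishes the two vertices.\<close>

definition gap :: "nat \<Rightarrow> nat ugraph set" where
  "gap i = {H \<in> Cp. 0 \<notin> verts H \<and> bv i \<notin> verts H \<and> {bv (Suc i), av (n - 1 - i)} \<in> edges H}"

text \<open>Copies containing both vertices cancel, and the exchange maps copies with only
  \<open>bv i\<close> to copies with only \<open>bv (Suc i)\<close>. No image lies in the gap: its
  edge would come from an edge between \<open>bv i\<close> and \<open>av (n - 1 - i)\<close>, whose
  indices add up to only n - 1.\<close>

lemma deg_off_bv_gap:
  assumes i: "Suc i < n"
  shows "deg_off (bv i) + card (gap i) \<le> deg_off (bv (Suc i))"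
proof -
  let ?\<phi> = "transpose (bv i) (bv (Suc i))"
  let ?A = "{H \<in> Cp. (0 \<notin> verts H \<and> bv i \<in> verts H) \<and> bv (Suc i) \<notin> verts H}"
  let ?S = "{H \<in> Cp. (0 \<notin> verts H \<and> bv (Suc i) \<in> verts H) \<and> bv i \<notin> verts H}"
  let ?B = "{H \<in> Cp. 0 \<notin> verts H \<and> bv i \<in> verts H \<and> bv (Suc i) \<in> verts H}"
  have "card ?A + card (gap i) \<le> card ?S"
  proof (rule card_add_le_by_graph_image[of ?\<phi>])
    show inj: "inj ?\<phi>" by simp
    show "finite ?S" by (rule finite_Cp)
    show "gap i \<subseteq> ?S" unfolding gap_def using edge_verts by blast
    fix H assume "H \<in> ?A"
    then have H: "H \<in> Cp" "0 \<notin> verts H" "bv i \<in> verts H" "bv (Suc i) \<notin> verts H" by auto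
    have V: "?\<phi> x \<in> verts G" if "x \<in> verts H" for x
      using vert_in_G[OF H(1) that] i by (auto simp: transpose_def)
    have Eb: "{bv (Suc i), y} \<in> edges G" if e: "{bv i, y} \<in> edges H" for y
    proof -
      have y: "y \<in> verts H" "{bv i, y} \<in> edges G" "y \<noteq> bv (Suc i)"
        using e edge_verts[OF H(1) e] H(4) edge_in_G[OF H(1)] by auto
      from vert_in_G[OF H(1) y(1)] show ?thesis
        by (cases rule: verts_irr_graph_cases) (use y i in auto)
    qed
    have E: "{?\<phi> x, ?\<phi> y} \<in> edges G" if e: "{x, y} \<in> edges H" for x y
    proof -
      have xy: "x \<noteq> bv (Suc i)" "y \<noteq> bv (Suc i)" "x \<noteq> y"
        using edge_verts[OF H(1) e] H(4) edge_endpoints_distinct[OF copiesD(1)[OF H(1)] e] by auto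
      have e': "{y, x} \<in> edges H" using e by (simp add: insert_commute)
      consider "x = bv i" | "y = bv i" | "x \<noteq> bv i" "y \<noteq> bv i" by blast
      then show ?thesis
      proof cases
        case 1
        then show ?thesis using Eb[of y] e xy by simp
      next
        case 2
        then show ?thesis using Eb[of x] e' xy by (simp add: insert_commute)
      next
        case 3
        then show ?thesis using edge_in_G[OF H(1) e] xy by simp
      qed
    qed
    have "graph_image ?\<phi> H \<in> Cp"
      using graph_image_copy[OF graph_F H(1) inj_on_subset[OF inj subset_UNIV]] V E by blast
    moreover have "0 \<notin> ?\<phi> ` verts H" using H(2) by (auto simp: transpose_def split: if_splits)
    moreover have "bv (Suc i) \<in> ?\<phi> ` verts H"
      using H(3) by (intro image_eqI[of _ _ "bv i"]) auto
    moreover have "bv i \<notin> ?\<phi> ` verts H" using H(4) by (auto simp: transpose_def split: if_splits)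
    ultimately show "graph_image ?\<phi> H \<in> ?S" by simp
    show "graph_image ?\<phi> H \<notin> gap i"
    proof
      assume "graph_image ?\<phi> H \<in> gap i"
      then have "{bv (Suc i), av (n - 1 - i)} \<in> edges (graph_image ?\<phi> H)" by (simp add: gap_def)
      then have "{bv i, av (n - 1 - i)} \<in> edges H"
        using graph_image_involution_edge_iff[of ?\<phi> "bv (Suc i)" "av (n - 1 - i)" H] by simp
      then show False using edge_in_G[OF H(1), of "bv i" "av (n - 1 - i)"] i by simp
    qed
  qed
  moreover have "deg_off (bv i) = card ?B + card ?A"
    unfolding deg_off_def
    using card_Collect_split[OF finite_copies[OF graph_G, of F],
        of "\<lambda>H. 0 \<notin> verts H \<and> bv i \<in> verts H"
          "\<lambda>H. bv (Suc i) \<in> verts H"]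
    by (simp add: conj_ac)
  moreover have "deg_off (bv (Suc i)) = card ?B + card ?S"
    unfolding deg_off_def
    using card_Collect_split[OF finite_copies[OF graph_G, of F],
        of "\<lambda>H. 0 \<notin> verts H \<and> bv (Suc i) \<in> verts H"
          "\<lambda>H. bv i \<in> verts H"]
    by (simp add: conj_ac)
  ultimately show ?thesis by simp
qed

text \<open>An edge of \<open>F\<close> is laid onto the distinguishing edge, and the other k - 2
  vertices go into a clique \<open>Q\<close> joined to both of its ends. The restriction on the
  vertex set allows these copies to be told apart later from images of copies through
  \<open>0\<close>.\<close>

lemma choose_le_card_gap:
  assumes i: "Suc i < n"
    and Q: "Q \<subseteq> verts G" "0 \<notin> Q" "bv i \<notin> Q" "bv (Suc i) \<notin> Q" "av (n - 1 - i) \<notin> Q"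
    and card_Q: "n div 4 \<le> card Q"
    and clique: "\<And>x y. x \<in> Q \<Longrightarrow> y \<in> Q \<Longrightarrow> x \<noteq> y \<Longrightarrow> {x, y} \<in> edges G"
      "\<And>x. x \<in> Q \<Longrightarrow> {bv (Suc i), x} \<in> edges G" "\<And>x. x \<in> Q \<Longrightarrow> {av (n - 1 - i), x} \<in> edges G"
  shows "(n div 4) choose (k - 2)
    \<le> card {H \<in> gap i. verts H \<subseteq> {bv (Suc i), av (n - 1 - i)} \<union> Q}"
proof -
  let ?b = "bv (Suc i)" and ?a = "av (n - 1 - i)"
  obtain u v where uv: "{u, v} \<in> edges F" "u \<in> verts F" "v \<in> verts F" "u \<noteq> v"
    using path_in_F by metis
  define h where "h x = (if x = u then ?b else ?a)" for x
  have h: "h u = ?b" "h v = ?a" "h ` {u, v} = {?b, ?a}" using uv(4) by (auto simp: h_def)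
  have hinj: "inj_on h {u, v}" using uv(4) by (auto simp: h_def inj_on_def)
  let ?S = "{H \<in> Cp. h ` {u, v} \<subseteq> verts H \<and> verts H \<subseteq> h ` {u, v} \<union> Q \<and>
      (\<forall>e\<in>edges F. e \<subseteq> {u, v} \<longrightarrow> h ` e \<in> edges H)}"
  have finQ: "finite Q" using Q(1) graph_G finite_subset by (auto simp: is_graph_def)
  have ba: "{?b, ?a} \<in> edges G" using i by simp
  have cl: "{x, y} \<in> edges G" if "x \<in> {?b, ?a} \<union> Q" "y \<in> {?b, ?a} \<union> Q" "x \<noteq> y" for x y
    using that clique ba by (auto simp: insert_commute)
  have "(n div 4) choose (k - 2) \<le> card Q choose (card (verts F) - card {u, v})"
    using binomial_right_mono[OF card_Q, of "k - 2"] uv(4) by (simp add: k_def numeral_2_eq_2)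
  also have "\<dots> \<le> card ?S"
  proof (rule choose_le_card_copies_in_clique[OF graph_F graph_G])
    show "{u, v} \<subseteq> verts F" using uv by simp
    show "inj_on h {u, v}" by (rule hinj)
    show "finite Q" by (rule finQ)
    show "Q \<inter> h ` {u, v} = {}" unfolding h(3) using Q by blast
    show "h ` {u, v} \<union> Q \<subseteq> verts G" unfolding h(3) using Q i by simp
    show "{x, y} \<in> edges G" if "x \<in> h ` {u, v} \<union> Q" "y \<in> h ` {u, v} \<union> Q" "x \<noteq> y" for x y
      using that cl unfolding h(3) by blast
  qed
  also have "\<dots> \<le> card {H \<in> gap i. verts H \<subseteq> {?b, ?a} \<union> Q}"
  proof (rule card_mono)
    show "finite {H \<in> gap i. verts H \<subseteq> {?b, ?a} \<union> Q}"
      using finite_Cp by (simp add: gap_def)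
    show "?S \<subseteq> {H \<in> gap i. verts H \<subseteq> {?b, ?a} \<union> Q}"
    proof
      fix H assume "H \<in> ?S"
      then have H: "H \<in> Cp" "verts H \<subseteq> {?b, ?a} \<union> Q" "h ` {u, v} \<in> edges H"
        using uv(1) unfolding h(3)[symmetric] by blast+
      have "0 \<notin> {?b, ?a} \<union> Q" "bv i \<notin> {?b, ?a} \<union> Q" using Q by auto
      then show "H \<in> {H \<in> gap i. verts H \<subseteq> {?b, ?a} \<union> Q}"
        using H unfolding gap_def h(3) by blast
    qed
  qed
  finally show ?thesis .
qed

text \<open>It suffices that the gap exceeds \<open>card X\<close> by the binomial coefficient in
  \<open>big\<close>, since the copies meeting \<open>R\<close> are fewer than that. The constant in
  \<open>big\<close> is the bound 2k + 1 on \<open>card R\<close> times the bound on the number of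
  edge sets.\<close>

lemma deg_on_av_less_gap:
  assumes i: "Suc i < n"
    and big: "(2 * k + 1) * 2 ^ 2 ^ k * (2 * n + 1) ^ (k - 3) < (n div 4) choose (k - 2)"
  shows "deg_on (av i) < card (gap i)"
proof -
  let ?b = "bv (Suc i)" and ?a = "av (n - 1 - i)"
  \<comment> \<open>Copies meeting \<open>R\<close> contain three prescribed vertices, so there are only $O(n^{k-3})$ of them.
    In the remaining ones \<open>0\<close> is a leaf hanging off \<open>av i\<close> and all other vertices are among the \<open>av j\<close>.\<close>
  define R where "R = (av ` {..<k} \<union> bv ` {n - k..<n} \<union> {?a}) - {av i}"
  define X where "X = {H \<in> Cp. 0 \<in> verts H \<and> av i \<in> verts H \<and> verts H \<inter> R = {}}"
  let ?Y = "\<lambda>r. {H \<in> Cp. {0, av i, r} \<subseteq> verts H}"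
  have R: "finite R" "card R \<le> 2 * k + 1" "0 \<notin> R" "av i \<notin> R"
  proof -
    have "card R \<le> card (av ` {..<k} \<union> bv ` {n - k..<n} \<union> {?a})"
      unfolding R_def by (rule card_mono) auto
    also have "\<dots> \<le> card (av ` {..<k}) + card (bv ` {n - k..<n}) + card {?a}"
      by (meson add_mono_thms_linordered_semiring(3) card_Un_le order_trans)
    also have "\<dots> \<le> 2 * k + 1"
      by (simp add: card_image inj_av inj_bv)
    finally show "card R \<le> 2 * k + 1" .
  qed (auto simp: R_def)
  have "{H \<in> Cp. 0 \<in> verts H \<and> av i \<in> verts H} \<subseteq> (\<Union>r\<in>R. ?Y r) \<union> X"
    unfolding X_def by blast
  then have "deg_on (av i) \<le> card ((\<Union>r\<in>R. ?Y r) \<union> X)"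
    unfolding deg_on_def
    by (rule card_mono[rotated]) (use R(1) finite_Cp in \<open>simp add: X_def\<close>)
  also have "\<dots> \<le> card (\<Union>r\<in>R. ?Y r) + card X" by (rule card_Un_le)
  also have "card (\<Union>r\<in>R. ?Y r) \<le> (\<Sum>r\<in>R. card (?Y r))" by (rule card_UN_le[OF R(1)])
  also have "\<dots> \<le> (\<Sum>r\<in>R. 2 ^ 2 ^ k * (2 * n + 1) ^ (k - 3))"
  proof (rule sum_mono)
    fix r assume "r \<in> R"
    then have "r \<noteq> 0" "r \<noteq> av i" using R(3,4) by metis+
    then have "card {0, av i, r} = 3" by auto
    then show "card (?Y r) \<le> 2 ^ 2 ^ k * (2 * n + 1) ^ (k - 3)"
      using card_copies_containing_le[OF graph_G, of "{0, av i, r}" F]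
      unfolding k_def[symmetric] by (metis card_verts_irr_graph finite.emptyI finite.insertI)
  qed
  also have "\<dots> \<le> (2 * k + 1) * (2 ^ 2 ^ k * (2 * n + 1) ^ (k - 3))"
    using R(2) by (simp only: sum_constant of_nat_id mult_le_mono1)
  finally have main: "deg_on (av i) \<le> (2 * k + 1) * 2 ^ 2 ^ k * (2 * n + 1) ^ (k - 3) + card X"
    by (simp only: mult.assoc add_le_cancel_right)
  \<comment> \<open>Diameter 2 provides a neighbour \<open>av j\<close> of \<open>0\<close> with j <
    k, and all of these except \<open>av i\<close> lie in \<open>R\<close>.\<close>
  have Xedge: "i < k \<and> {0, av i} \<in> edges H" if "H \<in> X" for H
  proof -
    have H: "H \<in> Cp" "0 \<in> verts H" "av i \<in> verts H" "verts H \<inter> R = {}" using that by (auto simp: X_def)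
    obtain j where j: "j < k" "{0, av j} \<in> edges H"
      using copy_neighbour_0[OF H(1-3)] by auto
    then have "av j \<notin> R" using edge_verts[OF H(1)] H(4) by blast
    then have "j = i" using j by (auto simp: R_def)
    then show ?thesis using j by simp
  qed
  have "card X + (n div 4 choose (k - 2)) \<le> card (gap i)"
  proof (cases "i < k")
    case False
    then have "X = {}" using Xedge by blast
    moreover have "(n div 4) choose (k - 2) \<le> card (gap i)"
    proof (cases "2 * i < n")
      case True
      \<comment> \<open>\<open>av (n - 1 - i)\<close> is adjacent to \<open>bv l\<close> from l = i
        + 1 on; omitting i + 1 itself leaves n - i - 2 vertices, enough while 2i < n.\<close>
      let ?Q = "bv ` {Suc (Suc i)..<n}"
      have "(n div 4) choose (k - 2) \<le> card {H \<in> gap i. verts H \<subseteq> {?b, ?a} \<union> ?Q}"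
      proof (rule choose_le_card_gap[OF i])
        show "n div 4 \<le> card ?Q" using True n_ge by (simp add: card_image inj_bv)
      qed (use i in auto)
      also have "\<dots> \<le> card (gap i)" using finite_Cp by (intro card_mono) (auto simp: gap_def)
      finally show ?thesis .
    next
      case i_large: False
      \<comment> \<open>The mirror choice for large i: \<open>bv (Suc i)\<close> is adjacent to
        \<open>av l\<close> from l = n - 1 - i on, and omitting that index leaves i
        vertices.\<close>
      let ?Q = "av ` {n - i..<n}"
      have "(n div 4) choose (k - 2) \<le> card {H \<in> gap i. verts H \<subseteq> {?b, ?a} \<union> ?Q}"
      proof (rule choose_le_card_gap[OF i])
        show "n div 4 \<le> card ?Q" using i_large n_ge i by (simp add: card_image inj_av)
      qed (use i in auto)
      also have "\<dots> \<le> card (gap i)" using finite_Cp by (intro card_mono) (auto simp: gap_def)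
      finally show ?thesis .
    qed
    ultimately show ?thesis by simp
  next
    case True
    let ?Q = "bv ` {Suc (Suc i)..<n}"
    let ?Z = "{H \<in> gap i. verts H \<subseteq> {?b, ?a} \<union> ?Q}"
    \<comment> \<open>Carries the edge from \<open>0\<close> to \<open>av i\<close> onto the
      distinguishing edge. Copies in \<open>X\<close> contain no \<open>bv l\<close> and not
      \<open>?a\<close>, which is in \<open>R\<close> because n - 1 - i differs from i; so their
      other vertices stay fixed.\<close>
    let ?\<phi> = "transpose 0 ?b \<circ> transpose (av i) ?a"
    have ii: "n - 1 - i \<noteq> i" using True n_ge by simp
    have "(n div 4) choose (k - 2) \<le> card ?Z"
    proof (rule choose_le_card_gap[OF i])
      show "n div 4 \<le> card ?Q" using True n_ge by (simp add: card_image inj_bv)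
    qed (use i in auto)
    moreover have "card X + card ?Z \<le> card (gap i)"
    proof (rule card_add_le_by_graph_image[of ?\<phi>])
      show inj: "inj ?\<phi>" by (rule inj_compose) simp_all
      show "finite (gap i)" unfolding gap_def by (rule finite_Cp)
      show "?Z \<subseteq> gap i" by blast
      fix H assume HX: "H \<in> X"
      then have H: "H \<in> Cp" "0 \<in> verts H" "av i \<in> verts H" "verts H \<inter> R = {}" by (auto simp: X_def)
      have aH: "?a \<notin> verts H" using H(4) ii by (auto simp: R_def)
      have vH: "x = 0 \<or> (\<exists>j<n. x = av j)" if "x \<in> verts H" for x
        using vert_in_G[OF H(1) that]
      proof (cases rule: verts_irr_graph_cases)
        case (3 l)
        then have "n < k + l" using copy_0_bv[OF H(1,2)] that by simp
        then have "x \<in> R" using 3 by (auto simp: R_def)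
        then show ?thesis using H(4) that by blast
      qed auto
      have \<phi>0: "?\<phi> 0 = ?b" and \<phi>i: "?\<phi> (av i) = ?a" by simp_all
      have \<phi>j: "?\<phi> (av j) = av j" if "av j \<in> verts H" "j \<noteq> i" for j
        using aH that by (auto simp: transpose_def)
      have \<phi>av: "\<exists>l<n. ?\<phi> (av j) = av l" if "av j \<in> verts H" for j
        using \<phi>i \<phi>j[OF that] vH[OF that] i by (cases "j = i") auto
      have V: "?\<phi> x \<in> verts G" if "x \<in> verts H" for x
        using vH[OF that] \<phi>av that \<phi>0 i by force
      \<comment> \<open>In \<open>H\<close> the vertex \<open>0\<close> is a leaf at
        \<open>av i\<close>, and \<open>?b\<close>, \<open>?a\<close> are adjacent since (i + 1) +
        (n - 1 - i) = n.\<close>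
      have E0: "{?\<phi> 0, ?\<phi> y} \<in> edges G" if e: "{0, y} \<in> edges H" for y
      proof -
        have "n \<ge> 1" using n_ge by simp
        then obtain j where j: "y = av j" "j < k"
          using irr_graph_neighbour_0[OF _ edge_in_G[OF H(1) e]] by blast
        then have "j = i" using edge_verts[OF H(1) e] H(4) by (auto simp: R_def)
        then show ?thesis using j \<phi>0 \<phi>i i by simp
      qed
      have E: "{?\<phi> x, ?\<phi> y} \<in> edges G" if e: "{x, y} \<in> edges H" for x y
      proof -
        have xy: "x \<in> verts H" "y \<in> verts H" "x \<noteq> y"
          using edge_verts[OF H(1) e] edge_endpoints_distinct[OF copiesD(1)[OF H(1)] e] by auto
        consider "x = 0" | "y = 0" | j l where "x = av j" "y = av l" using vH xy by metis
        then show ?thesis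
        proof cases
          case 1
          then show ?thesis using E0 e by blast
        next
          case 2
          then have "{?\<phi> 0, ?\<phi> x} \<in> edges G" using E0[of x] e by (simp add: insert_commute)
          then show ?thesis unfolding 2 by (simp only: insert_commute)
        next
          case 3
          obtain p q where pq: "p < n" "q < n" "?\<phi> x = av p" "?\<phi> y = av q"
            using \<phi>av xy 3 by metis
          moreover have "?\<phi> x \<noteq> ?\<phi> y" using inj xy(3) by (metis injD)
          ultimately show ?thesis by simp
        qed
      qed
      have img: "?\<phi> x = ?b \<or> (\<exists>l<n. ?\<phi> x = av l)" if "x \<in> verts H" for x
        using vH[OF that] \<phi>av that \<phi>0 by blast
      have not_img: "0 \<notin> ?\<phi> ` verts H" "bv i \<notin> ?\<phi> ` verts H"
      proof -
        show "0 \<notin> ?\<phi> ` verts H"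
        proof
          assume "0 \<in> ?\<phi> ` verts H"
          then obtain x where "x \<in> verts H" "0 = ?\<phi> x" by (rule imageE)
          then show False using img[of x] by (metis av_bv_simps(6,8))
        qed
        show "bv i \<notin> ?\<phi> ` verts H"
        proof
          assume "bv i \<in> ?\<phi> ` verts H"
          then obtain x where "x \<in> verts H" "bv i = ?\<phi> x" by (rule imageE)
          then show False using img[of x] by (metis av_bv_simps(2,4) n_not_Suc_n)
        qed
      qed
      have "graph_image ?\<phi> H \<in> Cp"
        using graph_image_copy[OF graph_F H(1) inj_on_subset[OF inj subset_UNIV]] V E by blast
      moreover have "{?b, ?a} \<in> edges (graph_image ?\<phi> H)"
      proof -
        have "?\<phi> ` {0, av i} \<in> edges (graph_image ?\<phi> H)"
          using Xedge[OF HX] by (simp only: edges_graph_image imageI)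
        moreover have "?\<phi> ` {0, av i} = {?b, ?a}" using \<phi>0 \<phi>i by simp
        ultimately show ?thesis by simp
      qed
      ultimately show "graph_image ?\<phi> H \<in> gap i"
        unfolding gap_def mem_Collect_eq verts_graph_image using not_img by blast
      show "graph_image ?\<phi> H \<notin> ?Z"
      proof
        assume Z: "graph_image ?\<phi> H \<in> ?Z"
        \<comment> \<open>As k \<ge> 3, there is a third vertex \<open>av j\<close>, fixed by the
          map; copies in \<open>?Z\<close> have no vertex of this clique besides
          \<open>?a\<close>.\<close>
        have "card {0, av i} < card (verts H)" using card_verts_copy[OF H(1)] k_ge_3 k_def by simp
        then obtain x where x: "x \<in> verts H" "x \<notin> {0, av i}"
          using card_mono[of "{0, av i}" "verts H"] by force
        then obtain j where j: "x = av j" "j \<noteq> i" using vH by blast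
        then have "av j \<in> ?\<phi> ` verts H" using \<phi>j x(1) by (metis imageI)
        moreover have "?\<phi> ` verts H \<subseteq> {?b, ?a} \<union> ?Q"
          using Z unfolding mem_Collect_eq verts_graph_image by blast
        ultimately have "av j \<in> {?b, ?a} \<union> ?Q" by blast
        then show False using j x(1) aH by auto
      qed
    qed
    ultimately show ?thesis by linarith
  qed
  then show ?thesis using main big by linarith
qed

text \<open>Here the order of growth decides: a copy through \<open>0\<close> contains one of its k
  neighbours, leaving k - 2 free vertices, whereas copies through \<open>bv 0\<close> inside its
  clique have k - 1 free vertices.\<close>

lemma F_degree_0_less:
  assumes big: "k * 2 ^ 2 ^ k * (2 * n + 1) ^ (k - 2) < (n div 4) choose (k - 1)"
  shows "F_degree F G 0 < F_degree F G (bv 0)"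
proof -
  let ?Y = "\<lambda>j. {H \<in> Cp. {0, av j} \<subseteq> verts H}"
  have "{H \<in> Cp. 0 \<in> verts H} \<subseteq> (\<Union>j<k. ?Y j)"
  proof
    fix H assume "H \<in> {H \<in> Cp. 0 \<in> verts H}"
    then have H: "H \<in> Cp" "0 \<in> verts H" by auto
    have "card {0::nat} < card (verts H)" using card_verts_copy[OF H(1)] k_ge_3 k_def by simp
    then obtain x where "x \<in> verts H" "x \<noteq> 0"
      using card_mono[of "{0}" "verts H"] by force
    then obtain j where "j < k" "{0, av j} \<in> edges H" using copy_neighbour_0[OF H] by metis
    then show "H \<in> (\<Union>j<k. ?Y j)" using edge_verts[OF H(1)] H by auto
  qed
  then have "F_degree F G 0 \<le> card (\<Union>j<k. ?Y j)"
    unfolding F_degree_eq by (rule card_mono[rotated]) (use finite_Cp in simp)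
  also have "\<dots> \<le> (\<Sum>j<k. card (?Y j))" by (rule card_UN_le) simp
  also have "\<dots> \<le> (\<Sum>j<k. 2 ^ 2 ^ k * (2 * n + 1) ^ (k - 2))"
  proof (rule sum_mono)
    fix j assume "j \<in> {..<k}"
    have "card {0, av j} = 2" by simp
    then show "card (?Y j) \<le> 2 ^ 2 ^ k * (2 * n + 1) ^ (k - 2)"
      using card_copies_containing_le[OF graph_G, of "{0, av j}" F]
      unfolding k_def[symmetric] by (metis card_verts_irr_graph finite.emptyI finite.insertI)
  qed
  also have "\<dots> < (n div 4) choose (k - 1)" using big by (simp add: mult.assoc)
  also have "\<dots> \<le> F_degree F G (bv 0)"
  proof -
    let ?Q = "bv ` {1..<n}"
    obtain u where u: "u \<in> verts F" using path_in_F by metis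
    let ?S = "{H \<in> Cp. (\<lambda>_. bv 0) ` {u} \<subseteq> verts H \<and> verts H \<subseteq> (\<lambda>_. bv 0) ` {u} \<union> ?Q \<and>
      (\<forall>e\<in>edges F. e \<subseteq> {u} \<longrightarrow> (\<lambda>_. bv 0) ` e \<in> edges H)}"
    have "(n div 4) choose (k - 1) \<le> card ?Q choose (card (verts F) - card {u})"
      using n_ge k_def by (simp add: card_image inj_bv binomial_right_mono)
    also have "\<dots> \<le> card ?S"
      using n_ge u by (intro choose_le_card_copies_in_clique[OF graph_F graph_G]) auto
    also have "\<dots> \<le> F_degree F G (bv 0)"
      unfolding F_degree_eq using finite_Cp by (intro card_mono) auto
    finally show ?thesis .
  qed
  finally show ?thesis .
qed

lemma F_irregular_irr_graph:
  assumes big: "(2 * k + 1) * 2 ^ 2 ^ k * (2 * n + 1) ^ (k - 3) < (n div 4) choose (k - 2)"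
    "k * 2 ^ 2 ^ k * (2 * n + 1) ^ (k - 2) < (n div 4) choose (k - 1)"
  shows "F_irregular F G"
proof -
  have step: "F_degree F G v < F_degree F G (Suc v)" if v: "v < 2 * n" for v
  proof -
    have "v \<in> verts G" using v by (simp add: verts_irr_graph)
    then show ?thesis
    proof (cases rule: verts_irr_graph_cases)
      case 1
      then show ?thesis using F_degree_0_less[OF big(2)] by (simp add: bv_def)
    next
      case (2 i)
      then have i: "Suc i < n" and v': "Suc v = bv (Suc i)" using v by (simp_all add: av_def bv_def)
      \<comment> \<open>The surplus of \<open>bv (Suc i)\<close> among copies avoiding
        \<open>0\<close> already outweighs all copies through \<open>0\<close> and
        \<open>av i\<close>; \<open>deg_on (bv (Suc i))\<close> is only bounded below by 0.\<close>
      have "F_degree F G (av i) < deg_off (bv i) + card (gap i)"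
        using deg_on_av_less_gap[OF i big(1)] by (simp add: F_degree_split deg_off_av)
      also have "\<dots> \<le> F_degree F G (bv (Suc i))"
        using deg_off_bv_gap[OF i] by (simp add: F_degree_split)
      finally show ?thesis using 2 v' by simp
    next
      case (3 i)
      then have "Suc v = av i" by (simp add: av_def bv_def)
      then show ?thesis
        using 3 deg_on_bv_less_av[OF 3(1)] by (simp add: F_degree_split deg_off_av)
    qed
  qed
  have less: "F_degree F G u < F_degree F G v" if "u < v" "v \<le> 2 * n" for u v
    using that
  proof (induction v)
    case (Suc v)
    then show ?case using step[of v] by (cases "u = v") auto
  qed simp
  show ?thesis
    unfolding F_irregular_def verts_irr_graph
    by (metis atMost_iff less linorder_neqE_nat less_irrefl)
qed

end

theorem theorem4:
  fixes F :: "'b ugraph"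
  assumes "is_graph F" and "has_diameter F 2"
  shows "\<exists>S :: nat ugraph set. infinite S \<and>
           (\<forall>G\<in>S. is_graph G \<and> has_diameter G 3 \<and> F_irregular F G) \<and>
           (\<forall>G\<in>S. \<forall>G'\<in>S. G \<noteq> G' \<longrightarrow> \<not> graph_iso G G')"
proof -
  define k where "k = card (verts F)"
  have setting: "irr_setting F k n" if "n \<ge> 4 * k + 8" for n
    using that assms k_def by unfold_locales
  have k3: "k \<ge> 3" using irr_setting.k_ge_3[OF setting] by blast
  obtain n1 where n1: "\<And>n. n \<ge> n1 \<Longrightarrow>
      (2 * k + 1) * 2 ^ 2 ^ k * (2 * n + 1) ^ (k - 3) < (n div 4) choose (k - 2)"
  proof -
    have "k - 2 - 1 = k - 3" "k - 2 \<ge> 1" using k3 by simp_all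
    then show ?thesis
      using power_lt_choose_quarter[of "k - 2" "(2 * k + 1) * 2 ^ 2 ^ k"] that by metis
  qed
  obtain n2 where n2: "\<And>n. n \<ge> n2 \<Longrightarrow>
      k * 2 ^ 2 ^ k * (2 * n + 1) ^ (k - 2) < (n div 4) choose (k - 1)"
  proof -
    have "k - 1 - 1 = k - 2" "k - 1 \<ge> 1" using k3 by simp_all
    then show ?thesis
      using power_lt_choose_quarter[of "k - 1" "k * 2 ^ 2 ^ k"] that by metis
  qed
  define n0 where "n0 = Max {n1, n2, 4 * k + 8}"
  have n0: "n1 \<le> n" "n2 \<le> n" "4 * k + 8 \<le> n" if "n0 \<le> n" for n
    using that by (auto simp: n0_def)
  let ?S = "(\<lambda>n. irr_graph n k) ` {n0..}"
  \<comment> \<open>The order 2n + 1 determines n, which yields both the infinitude of the family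
    and the non-isomorphism of its members.\<close>
  have card_eq: "n = m" if "card (verts (irr_graph n k)) = card (verts (irr_graph m k))" for n m
    using that by simp
  have "inj_on (\<lambda>n. irr_graph n k) {n0..}"
    by (rule inj_onI) (metis card_eq)
  then have infinite_S: "infinite ?S" using infinite_Ici finite_imageD by blast
  have irregular_S: "is_graph G \<and> has_diameter G 3 \<and> F_irregular F G" if "G \<in> ?S" for G
  proof -
    obtain n where n: "n0 \<le> n" "G = irr_graph n k" using \<open>G \<in> ?S\<close> by auto
    then show ?thesis
      using irr_setting.F_irregular_irr_graph[OF setting n1 n2] n0[OF n(1)] k3
        is_graph_irr_graph[of n k] has_diameter_irr_graph[of n k]
      by simp
  qed
  have non_iso_S: "\<not> graph_iso G G'" if "G \<in> ?S" "G' \<in> ?S" "G \<noteq> G'" for G G'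
  proof
    assume "graph_iso G G'"
    then have "card (verts G) = card (verts G')" by (auto simp: graph_iso_def bij_betw_same_card)
    then show False using that card_eq by blast
  qed
  show ?thesis
  proof (intro exI[of _ ?S] conjI[OF infinite_S] conjI)
    show "\<forall>G\<in>?S. is_graph G \<and> has_diameter G 3 \<and> F_irregular F G"
      by (rule ballI) (rule irregular_S)
    show "\<forall>G\<in>?S. \<forall>G'\<in>?S. G \<noteq> G' \<longrightarrow> \<not> graph_iso G G'"
      by (intro ballI impI) (rule non_iso_S)
  qed
qed

end
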